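(* There is a computable dense set $C\subset\omega\times\omega$ such that for any infinite computably enumerable set $A\subset\omega$, the product $A\times A$ is not a subset of $C$.
   Context: A set $S\subseteq\omega\times\omega$ is dense if it has asymptotic density 1, i.e. $\lim_{n\to\infty}|S\cap(n\times n)|/n^2=1$, where $n=\{0,\dots,n-1\}$. *)

theory Defs
  imports Complex_Main
begin

section \<open>Partial recursive functions\<close>

datatype recf =
    Zero
  | Succ
  | Proj nat
  | Comp recf "recf list"
  | PrimRec recf recf
  | Mu recf

text \<open>
  \<open>recf_eval r xs y\<close> says that the partial function denoted by \<open>r\<close> is defined on the tuple
  \<open>xs\<close> and has the value \<open>y\<close> there. Codes carry no arity: a code denotes one partial recursive
  function for every arity \<open>length xs\<close>. On a tuple whose length does not fit the code, such as
  \<open>Succ\<close> on a pair or \<open>Proj i\<close> on at most \<open>i\<close> arguments, it is simply undefined. The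
  recursion variable of \<open>PrimRec\<close> and the search variable of \<open>Mu\<close> come first, and in the
  second argument of \<open>PrimRec\<close> the previous value precedes them. The rule for \<open>Mu\<close> requires
  the searched function to be defined and nonzero at all smaller arguments.
\<close>

inductive recf_eval :: "recf \<Rightarrow> nat list \<Rightarrow> nat \<Rightarrow> bool" where
  Zero: "recf_eval Zero xs 0"
| Succ: "recf_eval Succ [x] (Suc x)"
| Proj: "i < length xs \<Longrightarrow> recf_eval (Proj i) xs (xs ! i)"
| Comp: "list_all2 (\<lambda>g y. recf_eval g xs y) gs ys \<Longrightarrow> recf_eval f ys z \<Longrightarrow>
    recf_eval (Comp f gs) xs z"
| PrimRec_0: "recf_eval f xs z \<Longrightarrow> recf_eval (PrimRec f g) (0 # xs) z"
| PrimRec_Suc: "recf_eval (PrimRec f g) (n # xs) y \<Longrightarrow> recf_eval g (y # n # xs) z \<Longrightarrow>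
    recf_eval (PrimRec f g) (Suc n # xs) z"
| Mu: "recf_eval f (n # xs) 0 \<Longrightarrow> (\<forall>i<n. \<exists>y. recf_eval f (i # xs) (Suc y)) \<Longrightarrow>
    recf_eval (Mu f) xs n"

lemma recf_eval_deterministic:
  assumes "recf_eval r xs y" and "recf_eval r xs y'"
  shows "y = y'"
  using assms
proof (induction arbitrary: y' rule: recf_eval.induct)
  case (Comp xs gs ys f z)
  from Comp.prems obtain ys' where
    ys': "list_all2 (\<lambda>g y. recf_eval g xs y) gs ys'" and z: "recf_eval f ys' y'"
    by (auto elim: recf_eval.cases)
  have "ys = ys'"
    using Comp.IH(1) ys' by (auto simp: list_all2_conv_all_nth intro!: nth_equalityI)
  with z Comp.IH show ?case by blast
next
  case (PrimRec_0 f xs z g)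
  from PrimRec_0.prems have "recf_eval f xs y'" by (auto elim: recf_eval.cases)
  with PrimRec_0.IH show ?case by blast
next
  case (PrimRec_Suc f g n xs y z)
  from PrimRec_Suc.prems obtain w where
    "recf_eval (PrimRec f g) (n # xs) w" and "recf_eval g (w # n # xs) y'"
    by (auto elim: recf_eval.cases)
  with PrimRec_Suc.IH show ?case by blast
next
  case (Mu f n xs)
  from Mu.prems have y': "recf_eval f (y' # xs) 0"
    and below: "\<forall>i<y'. \<exists>y. recf_eval f (i # xs) (Suc y)"
    by (auto elim: recf_eval.cases)
  show ?case
  proof (cases n y' rule: linorder_cases)
    case less
    with below Mu.IH(1) show ?thesis by blast
  next
    case greater
    with y' Mu.IH(2) show ?thesis by blast
  qed
qed (auto elim: recf_eval.cases)


section \<open>Computable and computably enumerable sets\<close>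

definition computable_rel :: "(nat \<times> nat) set \<Rightarrow> bool" where
  "computable_rel C \<longleftrightarrow> (\<exists>r. \<forall>x y. recf_eval r [x, y] (if (x, y) \<in> C then 1 else 0))"

definition computably_enumerable :: "nat set \<Rightarrow> bool" where
  "computably_enumerable A \<longleftrightarrow> (\<exists>r. A = {x. \<exists>y. recf_eval r [x] y})"


section \<open>Asymptotic density\<close>

definition has_asymptotic_density :: "(nat \<times> nat) set \<Rightarrow> real \<Rightarrow> bool" where
  "has_asymptotic_density S d \<longleftrightarrow>
    (\<lambda>n. real (card (S \<inter> ({..<n} \<times> {..<n}))) / (real n)\<^sup>2) \<longlonglongrightarrow> d"

definition dense_set :: "(nat \<times> nat) set \<Rightarrow> bool" where
  "dense_set S \<longleftrightarrow> has_asymptotic_density S 1"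

end

theory Submission
  imports Defs "HOL-Library.Nat_Bijection" "HOL-Real_Asymp.Real_Asymp"
begin

text \<open>
  Write \<open>W\<^sub>e\<close> for the computably enumerable set with index \<open>e\<close>. As in Post's construction
  of a simple set, let \<open>x\<^sub>e\<close> be the first number that an enumeration of \<open>W\<^sub>e\<close> produces among those
  that are at least \<open>triangle e = e (e + 1) / 2\<close>; it exists when \<open>W\<^sub>e\<close> is infinite. At most
  about \<open>sqrt (2 n)\<close> of the numbers \<open>x\<^sub>e\<close> lie below \<open>n\<close>. Let \<open>C\<close> consist of the pairs \<open>(x, y)\<close>
  such that \<open>x\<close> has not been recognized as one of the \<open>x\<^sub>e\<close> by stage \<open>y\<close>.

  Membership in \<open>C\<close> is decided by running finitely many enumerations up to stage \<open>y\<close>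
  (\<open>computable_rel_late_columns\<close>). The complement of \<open>C\<close> lies in the union of the columns above
  the \<open>x\<^sub>e\<close>, which has density 0 (\<open>dense_set_late_columns\<close>). An infinite \<open>W\<^sub>e\<close> contains \<open>x\<^sub>e\<close>
  and also some \<open>y\<close> beyond the stage at which \<open>x\<^sub>e\<close> is recognized, and \<open>(x\<^sub>e, y)\<close> is then a point
  of \<open>W\<^sub>e \<times> W\<^sub>e\<close> outside \<open>C\<close> (\<open>square_meets_late_columns\<close>).

  The remaining ingredient is a uniform enumeration of all \<open>W\<^sub>e\<close> with decidable stages, that is,
  a form of Kleene's normal form theorem. Evaluation of a code is carried out by a stack
  machine (\<open>machine_halts_iff\<close>) whose single step is a fixed case distinction on pairs of numbers.
  Total computable functions are closed under pairing, case distinction and iteration, so the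
  state after \<open>n\<close> steps is computable from a code, an argument and \<open>n\<close>. The explicit stack thus
  turns recursion over codes into iteration of one simple function.
\<close>

section \<open>Total computable functions\<close>

definition computable1 :: "(nat \<Rightarrow> nat) \<Rightarrow> bool" where
  "computable1 f \<longleftrightarrow> (\<exists>r. \<forall>x. recf_eval r [x] (f x))"

definition computable2 :: "(nat \<Rightarrow> nat \<Rightarrow> nat) \<Rightarrow> bool" where
  "computable2 f \<longleftrightarrow> (\<exists>r. \<forall>x y. recf_eval r [x, y] (f x y))"

definition decidable :: "(nat \<Rightarrow> bool) \<Rightarrow> bool" where
  "decidable P \<longleftrightarrow> computable1 (\<lambda>x. of_bool (P x))"

lemma recf_eval_Comp1:
  assumes "recf_eval g xs y" "recf_eval f [y] z"
  shows "recf_eval (Comp f [g]) xs z"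
  using assms by (auto intro!: recf_eval.Comp[where ys = "[y]"])

lemma recf_eval_Comp2:
  assumes "recf_eval g xs y" "recf_eval h xs y'" "recf_eval f [y, y'] z"
  shows "recf_eval (Comp f [g, h]) xs z"
  using assms by (auto intro!: recf_eval.Comp[where ys = "[y, y']"])

lemma recf_eval_Proj0: "recf_eval (Proj 0) (x # xs) x"
  using recf_eval.Proj[of 0 "x # xs"] by simp

lemma recf_eval_Proj1: "recf_eval (Proj 1) (x # y # xs) y"
  using recf_eval.Proj[of 1 "x # y # xs"] by simp

lemma computable1_id: "computable1 (\<lambda>x. x)"
  unfolding computable1_def using recf_eval_Proj0 by blast

lemma computable1_compose:
  assumes "computable1 f" "computable1 g"
  shows "computable1 (\<lambda>x. f (g x))"
  using assms unfolding computable1_def by (meson recf_eval_Comp1)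

lemma computable1_compose2:
  assumes "computable2 f" "computable1 g" "computable1 h"
  shows "computable1 (\<lambda>x. f (g x) (h x))"
  using assms unfolding computable1_def computable2_def by (meson recf_eval_Comp2)

lemma computable2_compose:
  assumes "computable1 f" "computable2 g"
  shows "computable2 (\<lambda>x y. f (g x y))"
  using assms unfolding computable1_def computable2_def by (meson recf_eval_Comp1)

lemma computable1_Suc:
  assumes "computable1 f"
  shows "computable1 (\<lambda>x. Suc (f x))"
proof -
  have "computable1 Suc"
    unfolding computable1_def using recf_eval.Succ by blast
  from computable1_compose[OF this assms] show ?thesis .
qed

lemma computable1_const: "computable1 (\<lambda>_. c)"
proof (induction c)
  case 0
  show ?case unfolding computable1_def using recf_eval.Zero by blast
qed (rule computable1_Suc)

lemma computable2_funpow: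
  assumes "computable1 F"
  shows "computable2 (\<lambda>n x. (F ^^ n) x)"
proof -
  from assms obtain r where r: "\<And>x. recf_eval r [x] (F x)"
    unfolding computable1_def by blast
  have "recf_eval (PrimRec (Proj 0) (Comp r [Proj 0])) [n, x] ((F ^^ n) x)" for n x
  proof (induction n)
    case 0
    show ?case using recf_eval.PrimRec_0[OF recf_eval_Proj0] by simp
  next
    case (Suc n)
    show ?case
      using recf_eval.PrimRec_Suc[OF Suc recf_eval_Comp1[OF recf_eval_Proj0 r]] by simp
  qed
  then show ?thesis unfolding computable2_def by blast
qed

lemmas computable1_funpow = computable1_compose2[OF computable2_funpow]

lemma computable1_pred: "computable1 (\<lambda>x. x - 1)"
proof -
  have "recf_eval (PrimRec Zero (Proj 1)) [n] (n - 1)" for n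
  proof (induction n)
    case 0
    show ?case using recf_eval.PrimRec_0[OF recf_eval.Zero] by simp
  next
    case (Suc n)
    show ?case using recf_eval.PrimRec_Suc[OF Suc recf_eval_Proj1] by simp
  qed
  then show ?thesis unfolding computable1_def by blast
qed

lemma computable2_add: "computable2 (+)"
proof -
  have "(Suc ^^ m) n = m + n" for m n
    by (induction m) auto
  with computable2_funpow[OF computable1_Suc[OF computable1_id]] show ?thesis
    by simp
qed

lemma computable2_diff: "computable2 (\<lambda>m n. n - m)"
proof -
  have "((\<lambda>x. x - 1) ^^ m) n = n - m" for m n :: nat
    by (induction m) auto
  with computable2_funpow[OF computable1_pred] show ?thesis
    by simp
qed

lemma computable1_diff:
  assumes "computable1 f" "computable1 g"
  shows "computable1 (\<lambda>x. f x - g x)"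
  using computable1_compose2[OF computable2_diff assms(2,1)] .

lemma computable1_triangle: "computable1 triangle"
proof -
  from computable2_add obtain a where a: "\<And>m n. recf_eval a [m, n] (m + n)"
    unfolding computable2_def by blast
  have "recf_eval (PrimRec Zero (Comp a [Proj 0, Comp Succ [Proj 1]])) [n] (triangle n)" for n
  proof (induction n)
    case 0
    show ?case using recf_eval.PrimRec_0[OF recf_eval.Zero] by simp
  next
    case (Suc n)
    have "recf_eval (Comp a [Proj 0, Comp Succ [Proj 1]]) [triangle n, n] (triangle n + Suc n)"
      by (intro recf_eval_Comp2[OF recf_eval_Proj0 _ a] recf_eval_Comp1[OF recf_eval_Proj1]
          recf_eval.Succ)
    with recf_eval.PrimRec_Suc[OF Suc this] show ?case by simp
  qed
  then show ?thesis unfolding computable1_def by blast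
qed

abbreviation pair :: "nat \<Rightarrow> nat \<Rightarrow> nat" ("\<langle>_, _\<rangle>") where
  "\<langle>m, n\<rangle> \<equiv> prod_encode (m, n)"

abbreviation left :: "nat \<Rightarrow> nat" where
  "left z \<equiv> fst (prod_decode z)"

abbreviation right :: "nat \<Rightarrow> nat" where
  "right z \<equiv> snd (prod_decode z)"

lemma computable2_pair: "computable2 pair"
proof -
  from computable1_triangle obtain t where t: "\<And>n. recf_eval t [n] (triangle n)"
    unfolding computable1_def by blast
  from computable2_add obtain a where a: "\<And>m n. recf_eval a [m, n] (m + n)"
    unfolding computable2_def by blast
  have "recf_eval (Comp a [Comp t [a], Proj 0]) [m, n] (triangle (m + n) + m)" for m n
    by (intro recf_eval_Comp2[OF _ recf_eval_Proj0 a] recf_eval_Comp1[OF a t])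
  then show ?thesis unfolding computable2_def prod_encode_def by auto
qed

lemmas computable1_pair = computable1_compose2[OF computable2_pair]

lemma triangle_mono: "m \<le> n \<Longrightarrow> triangle m \<le> triangle n"
  unfolding triangle_def by (intro div_le_mono mult_le_mono) auto

text \<open>
  The pairs with coordinate sum \<open>k\<close> receive the codes in
  \<open>[triangle k, triangle (Suc k))\<close>, so this sum can be found by unbounded search, and the
  coordinates are then obtained by subtraction.
\<close>
lemma computable1_coordinate_sum: "computable1 (\<lambda>z. left z + right z)"
proof -
  from computable2_diff obtain d where d: "\<And>m n. recf_eval d [m, n] (n - m)"
    unfolding computable2_def by blast
  from computable1_triangle obtain t where t: "\<And>n. recf_eval t [n] (triangle n)"
    unfolding computable1_def by blast
  define q where "q = Comp d [Comp t [Comp Succ [Proj 0]], Comp Succ [Proj 1]]"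
  have q: "recf_eval q [k, z] (Suc z - triangle (Suc k))" for k z
    unfolding q_def
    by (intro recf_eval_Comp2[OF _ _ d] recf_eval_Comp1[OF _ t]
        recf_eval_Comp1[OF recf_eval_Proj0] recf_eval_Comp1[OF recf_eval_Proj1] recf_eval.Succ)
  have "recf_eval (Mu q) [\<langle>m, n\<rangle>] (m + n)" for m n
  proof (rule recf_eval.Mu)
    have "Suc \<langle>m, n\<rangle> - triangle (Suc (m + n)) = 0"
      by (simp add: prod_encode_def)
    with q[of "m + n" "\<langle>m, n\<rangle>"] show "recf_eval q [m + n, \<langle>m, n\<rangle>] 0"
      by simp
    have "\<exists>y. Suc \<langle>m, n\<rangle> - triangle (Suc k) = Suc y" if "k < m + n" for k
      using triangle_mono[of "Suc k" "m + n"] that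
      by (intro exI[of _ "\<langle>m, n\<rangle> - triangle (Suc k)"])
        (simp add: prod_encode_def Suc_diff_le del: triangle_Suc)
    then show "\<forall>k<m + n. \<exists>y. recf_eval q [k, \<langle>m, n\<rangle>] (Suc y)"
      using q by metis
  qed
  then have "recf_eval (Mu q) [z] (left z + right z)" for z
    by (metis prod_decode_inverse prod.collapse)
  then show ?thesis unfolding computable1_def by blast
qed

lemma computable1_left:
  assumes "computable1 f"
  shows "computable1 (\<lambda>x. left (f x))"
proof -
  have "z - triangle (left z + right z) = left z" for z
  proof -
    have "z = triangle (left z + right z) + left z"
      using prod_decode_inverse[of z] unfolding prod_encode_def by (simp add: case_prod_beta)
    then show ?thesis by linarith
  qed
  moreover have "computable1 (\<lambda>z. z - triangle (left z + right z))"
    by (intro computable1_diff computable1_id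
        computable1_compose[OF computable1_triangle] computable1_coordinate_sum)
  ultimately have "computable1 left" by simp
  from computable1_compose[OF this assms] show ?thesis .
qed

lemma computable1_right:
  assumes "computable1 f"
  shows "computable1 (\<lambda>x. right (f x))"
proof -
  have "computable1 (\<lambda>z. left z + right z - left z)"
    by (intro computable1_diff computable1_left computable1_id computable1_coordinate_sum)
  then have "computable1 right" by simp
  from computable1_compose[OF this assms] show ?thesis .
qed

text \<open>
  The branch is chosen without a ternary function: exchange the components of the pair of the
  two values once or not at all, according to the truth value, and take the first one.
\<close>
lemma computable1_if:
  assumes "decidable P" "computable1 f" "computable1 g"
  shows "computable1 (\<lambda>x. if P x then f x else g x)"
proof -
  have "computable1 (\<lambda>x. left (((\<lambda>z. \<langle>right z, left z\<rangle>) ^^ of_bool (P x)) \<langle>g x, f x\<rangle>))"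
    using assms unfolding decidable_def
    by (intro computable1_left computable1_funpow computable1_pair computable1_right
        computable1_id)
  moreover have "(\<lambda>x. left (((\<lambda>z. \<langle>right z, left z\<rangle>) ^^ of_bool (P x)) \<langle>g x, f x\<rangle>))
      = (\<lambda>x. if P x then f x else g x)"
    by auto
  ultimately show ?thesis by simp
qed

lemma decidable_le:
  assumes "computable1 f" "computable1 g"
  shows "decidable (\<lambda>x. f x \<le> g x)"
proof -
  have "computable1 (\<lambda>x. 1 - (f x - g x))"
    using assms by (intro computable1_diff computable1_const)
  moreover have "1 - (f x - g x) = of_bool (f x \<le> g x)" for x
    by auto
  ultimately show ?thesis unfolding decidable_def by simp
qed

lemma decidable_not:
  assumes "decidable P"
  shows "decidable (\<lambda>x. \<not> P x)"
proof -
  have "computable1 (\<lambda>x. 1 - of_bool (P x))"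
    using assms unfolding decidable_def by (intro computable1_diff computable1_const)
  moreover have "1 - of_bool (P x) = (of_bool (\<not> P x) :: nat)" for x
    by auto
  ultimately show ?thesis unfolding decidable_def by simp
qed

lemma decidable_conj:
  assumes "decidable P" "decidable Q"
  shows "decidable (\<lambda>x. P x \<and> Q x)"
proof -
  have "computable1 (\<lambda>x. if P x then of_bool (Q x) else 0)"
    using assms by (intro computable1_if computable1_const) (auto simp: decidable_def)
  moreover have "(if P x then of_bool (Q x) else 0) = (of_bool (P x \<and> Q x) :: nat)" for x
    by auto
  ultimately show ?thesis unfolding decidable_def by simp
qed

lemma decidable_eq:
  assumes "computable1 f" "computable1 g"
  shows "decidable (\<lambda>x. f x = g x)"
  using decidable_conj[OF decidable_le[OF assms] decidable_le[OF assms(2,1)]]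
  by (simp add: order_eq_iff)

text \<open>
  A bounded search iterates a map on states \<open>\<langle>t, \<langle>b, x\<rangle>\<rangle>\<close> that
  advances the counter \<open>t\<close> and records in \<open>b\<close> whether a witness has been met.
\<close>
lemma decidable_bex:
  assumes "decidable (\<lambda>z. P (left z) (right z))" "computable1 f"
  shows "decidable (\<lambda>x. \<exists>t<f x. P t x)"
proof -
  define F where
    "F z = \<langle>Suc (left z), \<langle>if P (left z) (right (right z)) then 1 else left (right z),
      right (right z)\<rangle>\<rangle>" for z
  have "decidable (\<lambda>z. P (left z) (right (right z)))"
  proof -
    have "computable1 (\<lambda>z. \<langle>left z, right (right z)\<rangle>)"
      by (intro computable1_pair computable1_left computable1_right computable1_id)
    from computable1_compose[OF assms(1)[unfolded decidable_def] this] show ?thesis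
      unfolding decidable_def by simp
  qed
  then have "computable1 F"
    unfolding F_def
    by (intro computable1_pair computable1_Suc computable1_if computable1_left
        computable1_right computable1_const computable1_id)
  then have "computable1 (\<lambda>x. left (right ((F ^^ f x) \<langle>0, \<langle>0, x\<rangle>\<rangle>)))"
    using assms(2)
    by (intro computable1_left computable1_right computable1_funpow computable1_pair
        computable1_const computable1_id)
  moreover have "(F ^^ n) \<langle>0, \<langle>0, x\<rangle>\<rangle> = \<langle>n, \<langle>of_bool (\<exists>t<n. P t x), x\<rangle>\<rangle>" for n x
    by (induction n) (auto simp: F_def less_Suc_eq)
  ultimately show ?thesis unfolding decidable_def by simp
qed

lemmas computability_intros =
  computable1_id computable1_const computable1_Suc computable1_funpow
  computable1_pair computable1_left computable1_right computable1_if
  computable1_compose[OF computable1_pred] computable1_compose[OF computable1_triangle]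
  decidable_le decidable_eq decidable_not decidable_conj decidable_bex


section \<open>A stack machine for partial recursive functions\<close>

datatype instr =
    Run recf
  | RunAll "recf list"
  | Save "recf list" "nat list"
  | Prepend nat
  | Attach "nat list"
  | Test recf nat "nat list"

text \<open>
  A state consists of a stack of instructions and of a current tuple. \<open>Run r\<close> replaces
  the tuple by the one-element tuple of the value of \<open>r\<close> there, and \<open>RunAll gs\<close> by the
  tuple of the values of all \<open>gs\<close>. The other instructions are continuations: they hold the
  data to be used once the value of a subcomputation is known. \<open>Test f n xs\<close> receives the
  value of \<open>f\<close> at \<open>n # xs\<close> and either ends the search or tries the next candidate. Each
  step is a bounded rearrangement of components of the state, which keeps it easy to compute on
  codes; even a projection is executed one component at a time. A nonempty stack for which no
  rule fits leaves the state fixed, so that such a computation never halts.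
\<close>
fun step :: "instr list \<times> nat list \<Rightarrow> instr list \<times> nat list" where
  "step (Run Zero # K, xs) = (K, [0])"
| "step (Run Succ # K, [x]) = (K, [Suc x])"
| "step (Run (Proj 0) # K, x # xs) = (K, [x])"
| "step (Run (Proj (Suc i)) # K, x # xs) = (Run (Proj i) # K, xs)"
| "step (Run (Comp f gs) # K, xs) = (RunAll gs # Run f # K, xs)"
| "step (Run (PrimRec f g) # K, 0 # xs) = (Run f # K, xs)"
| "step (Run (PrimRec f g) # K, Suc n # xs) =
    (Run (PrimRec f g) # Attach (n # xs) # Run g # K, n # xs)"
| "step (Run (Mu f) # K, xs) = (Run f # Test f 0 xs # K, 0 # xs)"
| "step (RunAll [] # K, xs) = (K, [])"
| "step (RunAll (g # gs) # K, xs) = (Run g # Save gs xs # K, xs)"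
| "step (Save gs xs # K, [y]) = (RunAll gs # Prepend y # K, xs)"
| "step (Prepend y # K, ys) = (K, y # ys)"
| "step (Attach xs # K, [y]) = (K, y # xs)"
| "step (Test f n xs # K, [0]) = (K, [n])"
| "step (Test f n xs # K, [Suc y]) = (Run f # Test f (Suc n) xs # K, Suc n # xs)"
| "step s = s"

definition reaches :: "instr list \<times> nat list \<Rightarrow> instr list \<times> nat list \<Rightarrow> bool" where
  "reaches s s' \<longleftrightarrow> (\<exists>n. (step ^^ n) s = s')"

lemma reaches_refl: "reaches s s"
  unfolding reaches_def by (rule exI[of _ 0]) simp

lemma reaches_step:
  assumes "reaches (step s) s'"
  shows "reaches s s'"
  using assms unfolding reaches_def by (metis comp_apply funpow_Suc_right)

lemma reaches_trans:
  assumes "reaches s s'" "reaches s' s''"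
  shows "reaches s s''"
  using assms unfolding reaches_def by (metis comp_apply funpow_add)

text \<open>
  The hypothesis has the shape of the induction hypothesis for the arguments of a composition.
\<close>
lemma reaches_RunAll:
  assumes "list_all2 (\<lambda>g y. \<forall>K. reaches (Run g # K, xs) (K, [y])) gs ys"
  shows "reaches (RunAll gs # K, xs) (K, ys)"
  using assms
proof (induction arbitrary: K rule: list_all2_induct)
  case Nil
  show ?case by (rule reaches_step) (simp add: reaches_refl)
next
  case (Cons g gs y ys)
  have "reaches (Run g # Save gs xs # K, xs) (Save gs xs # K, [y])"
    using Cons by blast
  moreover have "reaches (Save gs xs # K, [y]) (Prepend y # K, ys)"
    by (rule reaches_step) (simp add: Cons)
  moreover have "reaches (Prepend y # K, ys) (K, y # ys)"
    by (rule reaches_step) (simp add: reaches_refl)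
  ultimately have "reaches (Run g # Save gs xs # K, xs) (K, y # ys)"
    by (blast intro: reaches_trans)
  then show ?case by (intro reaches_step[of "(RunAll (g # gs) # K, xs)"]) simp
qed

lemma reaches_Run:
  assumes "recf_eval r xs y"
  shows "reaches (Run r # K, xs) (K, [y])"
  using assms
proof (induction arbitrary: K rule: recf_eval.induct)
  case (Zero xs)
  show ?case by (rule reaches_step) (simp add: reaches_refl)
next
  case (Succ x)
  show ?case by (rule reaches_step) (simp add: reaches_refl)
next
  case (Proj i xs)
  then show ?case
  proof (induction i arbitrary: xs)
    case 0
    then obtain x xs' where "xs = x # xs'" by (cases xs) auto
    then show ?case by (intro reaches_step[of "(Run (Proj 0) # K, xs)"]) (simp add: reaches_refl)
  next
    case (Suc i)
    then obtain x xs' where "xs = x # xs'" by (cases xs) auto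
    with Suc show ?case by (intro reaches_step[of "(Run (Proj (Suc i)) # K, xs)"]) simp
  qed
next
  case (Comp xs gs ys f z)
  have "reaches (RunAll gs # Run f # K, xs) (Run f # K, ys)"
    using Comp.IH(1) by (intro reaches_RunAll) (auto elim: list_all2_mono)
  with Comp.IH(2) have "reaches (RunAll gs # Run f # K, xs) (K, [z])"
    by (blast intro: reaches_trans)
  then show ?case by (intro reaches_step[of "(Run (Comp f gs) # K, xs)"]) simp
next
  case (PrimRec_0 f xs z g)
  then show ?case by (intro reaches_step[of "(Run (PrimRec f g) # K, 0 # xs)"]) simp
next
  case (PrimRec_Suc f g n xs y z)
  have "reaches (Attach (n # xs) # Run g # K, [y]) (K, [z])"
    by (rule reaches_step) (simp add: PrimRec_Suc)
  with PrimRec_Suc.IH(1)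
  have "reaches (Run (PrimRec f g) # Attach (n # xs) # Run g # K, n # xs) (K, [z])"
    by (blast intro: reaches_trans)
  then show ?case by (intro reaches_step[of "(Run (PrimRec f g) # K, Suc n # xs)"]) simp
next
  case (Mu f n xs)
  have "reaches (Run f # Test f 0 xs # K, 0 # xs) (Run f # Test f k xs # K, k # xs)" if "k \<le> n" for k
    using that
  proof (induction k)
    case 0
    show ?case by (rule reaches_refl)
  next
    case (Suc k)
    from Mu.IH(2) Suc.prems obtain y where
      "reaches (Run f # Test f k xs # K, k # xs) (Test f k xs # K, [Suc y])"
      by (meson Suc_le_lessD)
    moreover have "reaches (Test f k xs # K, [Suc y]) (Run f # Test f (Suc k) xs # K, Suc k # xs)"
      by (rule reaches_step) (simp add: reaches_refl)
    ultimately show ?case using Suc by (meson Suc_leD reaches_trans)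
  qed
  moreover have "reaches (Run f # Test f n xs # K, n # xs) (Test f n xs # K, [0])"
    by (rule Mu.IH(1))
  moreover have "reaches (Test f n xs # K, [0]) (K, [n])"
    by (rule reaches_step) (simp add: reaches_refl)
  ultimately have "reaches (Run f # Test f 0 xs # K, 0 # xs) (K, [n])"
    by (meson order_refl reaches_trans)
  then show ?case by (intro reaches_step[of "(Run (Mu f) # K, xs)"]) simp
qed

text \<open>
  That a halting run comes from a defined value is proved backwards along the run, for which one
  needs a property of arbitrary stacks that holds for the empty stack and passes from the result of
  a step to its origin. This is the denotational reading of a stack: executed on the given tuple,
  it runs to completion.
  In the second case of \<open>Test\<close>, \<open>z\<close> is the result of the search that is resumed above \<open>n\<close>.
\<close>
fun defined_on :: "instr list \<Rightarrow> nat list \<Rightarrow> bool" where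
  "defined_on [] v \<longleftrightarrow> True"
| "defined_on (Run r # K) v \<longleftrightarrow> (\<exists>y. recf_eval r v y \<and> defined_on K [y])"
| "defined_on (RunAll gs # K) v \<longleftrightarrow>
    (\<exists>ys. list_all2 (\<lambda>g y. recf_eval g v y) gs ys \<and> defined_on K ys)"
| "defined_on (Save gs xs # K) v \<longleftrightarrow>
    (\<exists>y ys. v = [y] \<and> list_all2 (\<lambda>g y. recf_eval g xs y) gs ys \<and> defined_on K (y # ys))"
| "defined_on (Prepend y # K) v \<longleftrightarrow> defined_on K (y # v)"
| "defined_on (Attach xs # K) v \<longleftrightarrow> (\<exists>y. v = [y] \<and> defined_on K (y # xs))"
| "defined_on (Test f n xs # K) v \<longleftrightarrow>
    v = [0] \<and> defined_on K [n] \<or>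
    (\<exists>y z. v = [Suc y] \<and> n < z \<and> recf_eval f (z # xs) 0 \<and>
      (\<forall>i. n < i \<and> i < z \<longrightarrow> (\<exists>y. recf_eval f (i # xs) (Suc y))) \<and> defined_on K [z])"

text \<open>
  Only the instructions whose meaning is not literally the premise of an evaluation rule need an
  argument: a projection, which the machine unwinds one component at a time, and the search of
  \<open>Mu\<close>, where the interval of rejected candidates grows by one at its lower end.
\<close>
lemma defined_on_step:
  assumes "defined_on (fst (step s)) (snd (step s))"
  shows "defined_on (fst s) (snd s)"
  using assms
proof (cases s rule: step.cases)
  \<comment> \<open>\<open>Run (Proj (Suc i))\<close>\<close>
  case (4 i K x xs)
  with assms obtain y where "recf_eval (Proj i) xs y" "defined_on K [y]"
    by auto
  moreover from this have "recf_eval (Proj (Suc i)) (x # xs) y"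
    using recf_eval.Proj[of "Suc i" "x # xs"] by (auto elim!: recf_eval.cases[of "Proj i"])
  ultimately show ?thesis using 4 by auto
next
  \<comment> \<open>\<open>Run (Mu f)\<close>: the outcome of the first \<open>Test\<close> decides whether 0 is the result\<close>
  case (8 f K xs)
  with assms consider "recf_eval f (0 # xs) 0" "defined_on K [0]"
    | y z where "recf_eval f (0 # xs) (Suc y)" "recf_eval f (z # xs) 0"
      "\<forall>i. 0 < i \<and> i < z \<longrightarrow> (\<exists>y. recf_eval f (i # xs) (Suc y))" "defined_on K [z]"
    by auto
  then show ?thesis
  proof cases
    case 1
    then have "recf_eval (Mu f) xs 0" by (intro recf_eval.Mu) auto
    with 1 8 show ?thesis by auto
  next
    case 2
    then have "recf_eval (Mu f) xs z"
      by (intro recf_eval.Mu) (metis gr0I)+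
    with 2 8 show ?thesis by auto
  qed
next
  \<comment> \<open>\<open>Test\<close> with a nonzero value, which resumes the search at \<open>Suc n\<close>\<close>
  case (15 f n xs K y)
  with assms consider "recf_eval f (Suc n # xs) 0" "defined_on K [Suc n]"
    | y z where "recf_eval f (Suc n # xs) (Suc y)" "Suc n < z" "recf_eval f (z # xs) 0"
      "\<forall>i. Suc n < i \<and> i < z \<longrightarrow> (\<exists>y. recf_eval f (i # xs) (Suc y))" "defined_on K [z]"
    by auto
  then show ?thesis
  proof cases
    case 1
    with 15 show ?thesis by auto
  next
    case 2
    then have "\<forall>i. n < i \<and> i < z \<longrightarrow> (\<exists>y. recf_eval f (i # xs) (Suc y))"
      by (metis Suc_lessI)
    with 2(2,3,5) have "\<exists>z>n. recf_eval f (z # xs) 0 \<and>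
        (\<forall>i. n < i \<and> i < z \<longrightarrow> (\<exists>y. recf_eval f (i # xs) (Suc y))) \<and> defined_on K [z]"
      by (blast intro: Suc_lessD)
    with 15 show ?thesis by simp
  qed
qed (auto intro: recf_eval.intros recf_eval_Proj0 simp: list_all2_Cons1)

theorem machine_halts_iff:
  "(\<exists>n. fst ((step ^^ n) ([Run r], xs)) = []) \<longleftrightarrow> (\<exists>y. recf_eval r xs y)"
proof
  assume "\<exists>n. fst ((step ^^ n) ([Run r], xs)) = []"
  then obtain n where "fst ((step ^^ n) ([Run r], xs)) = []" ..
  then have "defined_on (fst ((step ^^ n) ([Run r], xs))) (snd ((step ^^ n) ([Run r], xs)))"
    by simp
  then have "defined_on [Run r] xs"
  proof (induction n)
    case (Suc n)
    then show ?case using defined_on_step by (metis comp_apply funpow.simps(2))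
  qed simp
  then show "\<exists>y. recf_eval r xs y" by simp
next
  assume "\<exists>y. recf_eval r xs y"
  then show "\<exists>n. fst ((step ^^ n) ([Run r], xs)) = []"
    using reaches_Run[of r xs _ "[]"] unfolding reaches_def by (metis fst_conv)
qed


section \<open>Arithmetization of the machine\<close>

text \<open>
  The tags of \<open>recf\<close> and of \<open>instr\<close> are numbered jointly, so that \<open>Run r\<close> needs no tag of
  its own and the code of \<open>r\<close> serves directly as an instruction.
\<close>
primrec recf_code :: "recf \<Rightarrow> nat" where
  "recf_code Zero = \<langle>0, 0\<rangle>"
| "recf_code Succ = \<langle>1, 0\<rangle>"
| "recf_code (Proj i) = \<langle>2, i\<rangle>"
| "recf_code (Comp f gs) = \<langle>3, \<langle>recf_code f, list_encode (map recf_code gs)\<rangle>\<rangle>"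
| "recf_code (PrimRec f g) = \<langle>4, \<langle>recf_code f, recf_code g\<rangle>\<rangle>"
| "recf_code (Mu f) = \<langle>5, recf_code f\<rangle>"

primrec instr_code :: "instr \<Rightarrow> nat" where
  "instr_code (Run r) = recf_code r"
| "instr_code (RunAll gs) = \<langle>6, list_encode (map recf_code gs)\<rangle>"
| "instr_code (Save gs xs) = \<langle>7, \<langle>list_encode (map recf_code gs), list_encode xs\<rangle>\<rangle>"
| "instr_code (Prepend y) = \<langle>8, y\<rangle>"
| "instr_code (Attach xs) = \<langle>9, list_encode xs\<rangle>"
| "instr_code (Test f n xs) = \<langle>10, \<langle>recf_code f, \<langle>n, list_encode xs\<rangle>\<rangle>\<rangle>"

definition state_code :: "instr list \<times> nat list \<Rightarrow> nat" where
  "state_code s = \<langle>list_encode (map instr_code (fst s)), list_encode (snd s)\<rangle>"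

text \<open>
  These are the list operations on the values of \<open>list_encode\<close>, where the empty list has the code 0.
\<close>
abbreviation ncons :: "nat \<Rightarrow> nat \<Rightarrow> nat" where
  "ncons x l \<equiv> Suc \<langle>x, l\<rangle>"

abbreviation nhd :: "nat \<Rightarrow> nat" where
  "nhd l \<equiv> left (l - 1)"

abbreviation ntl :: "nat \<Rightarrow> nat" where
  "ntl l \<equiv> right (l - 1)"

text \<open>
  The condition \<open>v \<noteq> 0 \<and> ntl v = 0\<close> says that \<open>v\<close> codes a one-element tuple.
\<close>
definition code_step :: "nat \<Rightarrow> nat" where
  "code_step s =
    (let stack = left s; v = right s; tag = left (nhd stack); d = right (nhd stack);
         K = ntl stack
     in if stack = 0 then s
        else if tag = 0 then \<langle>K, ncons 0 0\<rangle>
        else if tag = 1 then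
          if v \<noteq> 0 \<and> ntl v = 0 then \<langle>K, ncons (Suc (nhd v)) 0\<rangle> else s
        else if tag = 2 then
          if v = 0 then s
          else if d = 0 then \<langle>K, ncons (nhd v) 0\<rangle>
          else \<langle>ncons \<langle>2, d - 1\<rangle> K, ntl v\<rangle>
        else if tag = 3 then \<langle>ncons \<langle>6, right d\<rangle> (ncons (left d) K), v\<rangle>
        else if tag = 4 then
          if v = 0 then s
          else if nhd v = 0 then \<langle>ncons (left d) K, ntl v\<rangle>
          else \<langle>ncons \<langle>4, d\<rangle> (ncons \<langle>9, ncons (nhd v - 1) (ntl v)\<rangle> (ncons (right d) K)),
            ncons (nhd v - 1) (ntl v)\<rangle>
        else if tag = 5 then \<langle>ncons d (ncons \<langle>10, \<langle>d, \<langle>0, v\<rangle>\<rangle>\<rangle> K), ncons 0 v\<rangle>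
        else if tag = 6 then
          if d = 0 then \<langle>K, 0\<rangle>
          else \<langle>ncons (nhd d) (ncons \<langle>7, \<langle>ntl d, v\<rangle>\<rangle> K), v\<rangle>
        else if tag = 7 then
          if v \<noteq> 0 \<and> ntl v = 0
          then \<langle>ncons \<langle>6, left d\<rangle> (ncons \<langle>8, nhd v\<rangle> K), right d\<rangle> else s
        else if tag = 8 then \<langle>K, ncons d v\<rangle>
        else if tag = 9 then
          if v \<noteq> 0 \<and> ntl v = 0 then \<langle>K, ncons (nhd v) d\<rangle> else s
        else
          if v \<noteq> 0 \<and> ntl v = 0 then
            if nhd v = 0 then \<langle>K, ncons (left (right d)) 0\<rangle>
            else \<langle>ncons (left d)
                (ncons \<langle>10, \<langle>left d, \<langle>Suc (left (right d)), right (right d)\<rangle>\<rangle>\<rangle> K),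
              ncons (Suc (left (right d))) (right (right d))\<rangle>
          else s)"

lemma computable1_code_step: "computable1 code_step"
  unfolding code_step_def Let_def by (intro computability_intros)

lemma code_step_state_code: "code_step (state_code s) = state_code (step s)"
  by (cases s rule: step.cases) (simp_all add: state_code_def code_step_def Let_def)

definition halts_within :: "nat \<Rightarrow> nat \<Rightarrow> nat \<Rightarrow> bool" where
  "halts_within e x n \<longleftrightarrow> left ((code_step ^^ n) \<langle>ncons e 0, ncons x 0\<rangle>) = 0"

lemma halts_within_iff:
  "(\<exists>n. halts_within (recf_code r) x n) \<longleftrightarrow> (\<exists>y. recf_eval r [x] y)"
proof -
  have "(code_step ^^ n) (state_code s) = state_code ((step ^^ n) s)" for n s
    by (induction n) (auto simp: code_step_state_code)
  moreover have "\<langle>ncons (recf_code r) 0, ncons x 0\<rangle> = state_code ([Run r], [x])"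
    by (simp add: state_code_def)
  moreover have "left (state_code s) = 0 \<longleftrightarrow> fst s = []" for s
    by (cases "fst s") (auto simp: state_code_def)
  ultimately show ?thesis
    unfolding halts_within_def by (simp add: machine_halts_iff)
qed


section \<open>A sparse simple set and the computable dense set\<close>

text \<open>
  A stage \<open>t\<close> codes a number together with a step bound, so that running through all \<open>t\<close> is a
  dovetailed enumeration of the set with index \<open>e\<close>. The bound \<open>triangle e\<close> keeps the selected
  numbers sparse.
\<close>
definition is_candidate :: "nat \<Rightarrow> nat \<Rightarrow> bool" where
  "is_candidate e t \<longleftrightarrow> triangle e \<le> left t \<and> halts_within e (left t) (right t)"

definition is_first_candidate :: "nat \<Rightarrow> nat \<Rightarrow> bool" where
  "is_first_candidate e t \<longleftrightarrow> is_candidate e t \<and> \<not> (\<exists>u<t. is_candidate e u)"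

text \<open>
  For each \<open>e\<close> this contains the part of the column above \<open>x\<^sub>e\<close> that starts at the stage where
  \<open>x\<^sub>e\<close> is recognized. The bound on \<open>e\<close> makes membership decidable and excludes nothing, because
  \<open>e \<le> triangle e \<le> x\<^sub>e\<close>.
\<close>
definition late_columns :: "(nat \<times> nat) set" where
  "late_columns = {(x, y). \<exists>e<Suc x. \<exists>t<Suc y. is_first_candidate e t \<and> left t = x}"

lemma computable_rel_late_columns: "computable_rel (- late_columns)"
proof -
  have "decidable (\<lambda>z. \<not> (\<exists>e<Suc (left z). \<exists>t<Suc (right z).
      is_first_candidate e t \<and> left t = left z))"
    unfolding is_first_candidate_def is_candidate_def halts_within_def
    by (intro computability_intros computable1_code_step)
  then have "computable1 (\<lambda>z. of_bool ((left z, right z) \<in> - late_columns))"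
    unfolding decidable_def late_columns_def by (simp add: case_prod_beta)
  from computable2_compose[OF this computable2_pair]
  have "computable2 (\<lambda>x y. of_bool ((x, y) \<in> - late_columns))"
    by simp
  then show ?thesis
    unfolding computable2_def computable_rel_def of_bool_def .
qed

lemma le_triangle: "n \<le> triangle n"
  by (induction n) auto

lemma indices_below_sqrt:
  assumes "triangle e < n"
  shows "real e < sqrt (2 * real n)"
proof -
  have "e * e \<le> 2 * triangle e" for e
    by (induction e) auto
  with assms have "e * e < 2 * n"
    by (meson le_less_trans mult_less_mono2 zero_less_numeral)
  then have "real e * real e < 2 * real n"
    by (metis of_nat_less_iff of_nat_mult of_nat_numeral)
  then show ?thesis
    by (intro real_less_rsqrt) (simp add: power2_eq_square)
qed

text \<open>
  Each index contributes points of at most one column, and the index of a column left of \<open>n\<close> is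
  below \<open>sqrt (2 n)\<close>.
\<close>
lemma card_late_columns_le:
  "real (card (late_columns \<inter> ({..<n} \<times> {..<n}))) \<le> (sqrt (2 * real n) + 1) * real n"
proof -
  define E where "E = {e. real e < sqrt (2 * real n)}"
  define column where "column e = left (LEAST t. is_candidate e t)" for e
  have E_subset: "E \<subseteq> {..<nat \<lceil>sqrt (2 * real n)\<rceil>}"
    unfolding E_def by (auto simp: less_ceiling_iff zless_nat_eq_int_zless)
  then have fin: "finite E" by (rule finite_subset) simp
  have "card E \<le> nat \<lceil>sqrt (2 * real n)\<rceil>"
    using card_mono[OF _ E_subset] by simp
  moreover have "real (nat \<lceil>sqrt (2 * real n)\<rceil>) \<le> sqrt (2 * real n) + 1"
    by simp
  ultimately have card_E: "real (card E) \<le> sqrt (2 * real n) + 1"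
    by linarith
  have "late_columns \<inter> ({..<n} \<times> {..<n}) \<subseteq> column ` E \<times> {..<n}"
  proof (rule subrelI)
    fix x y
    assume xy: "(x, y) \<in> late_columns \<inter> ({..<n} \<times> {..<n})"
    then have bounds: "x \<in> {..<n}" "y \<in> {..<n}" by auto
    from xy obtain e t where t: "is_first_candidate e t" "left t = x"
      unfolding late_columns_def by blast
    then have "(LEAST t. is_candidate e t) = t"
      unfolding is_first_candidate_def by (intro Least_equality) (auto simp: not_less)
    then have "column e = x" using t unfolding column_def by simp
    moreover have "e \<in> E"
      using t bounds indices_below_sqrt[of e n]
      unfolding E_def is_first_candidate_def is_candidate_def by auto
    ultimately show "(x, y) \<in> column ` E \<times> {..<n}" using bounds by auto
  qed
  then have "card (late_columns \<inter> ({..<n} \<times> {..<n})) \<le> card (column ` E \<times> {..<n})"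
    using fin by (intro card_mono) auto
  also have "\<dots> \<le> card E * n"
    using card_image_le[OF fin, of column] by (simp add: card_cartesian_product)
  finally have "real (card (late_columns \<inter> ({..<n} \<times> {..<n}))) \<le> real (card E) * real n"
    by (metis of_nat_le_iff of_nat_mult)
  also have "\<dots> \<le> (sqrt (2 * real n) + 1) * real n"
    using card_E by (intro mult_right_mono) auto
  finally show ?thesis .
qed

lemma dense_set_late_columns: "dense_set (- late_columns)"
proof -
  define ratio where
    "ratio n = real (card (- late_columns \<inter> ({..<n} \<times> {..<n}))) / (real n)\<^sup>2" for n :: nat
  have card_sum: "card (- late_columns \<inter> ({..<n} \<times> {..<n}))
      + card (late_columns \<inter> ({..<n} \<times> {..<n})) = n * n" for n
  proof -
    have "card (({..<n} \<times> {..<n}) \<inter> late_columns) + card (({..<n} \<times> {..<n}) - late_columns)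
        = card ({..<n} \<times> {..<n})"
      by (rule card_Int_Diff[symmetric]) simp
    then show ?thesis
      by (simp add: card_cartesian_product Diff_eq Int_commute add.commute)
  qed
  have upper: "ratio n \<le> 1" if "n > 0" for n
  proof -
    have "card (- late_columns \<inter> ({..<n} \<times> {..<n})) \<le> n * n"
      using card_sum[of n] by linarith
    then have "real (card (- late_columns \<inter> ({..<n} \<times> {..<n}))) \<le> (real n)\<^sup>2"
      by (metis of_nat_le_iff of_nat_mult power2_eq_square)
    then show ?thesis unfolding ratio_def using that by simp
  qed
  have lower: "1 - (sqrt (2 * real n) + 1) / real n \<le> ratio n" if "n > 0" for n
  proof -
    have "real (card (- late_columns \<inter> ({..<n} \<times> {..<n})))
        + real (card (late_columns \<inter> ({..<n} \<times> {..<n}))) = real n * real n"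
      using card_sum[of n] by (metis of_nat_add of_nat_mult)
    with card_late_columns_le[of n]
    have "real n * real n - (sqrt (2 * real n) + 1) * real n
        \<le> real (card (- late_columns \<inter> ({..<n} \<times> {..<n})))"
      by linarith
    then have "(real n * real n - (sqrt (2 * real n) + 1) * real n) / (real n)\<^sup>2 \<le> ratio n"
      unfolding ratio_def by (intro divide_right_mono) auto
    moreover have "(real n * real n - (sqrt (2 * real n) + 1) * real n) / (real n)\<^sup>2
        = 1 - (sqrt (2 * real n) + 1) / real n"
      using that by (simp add: diff_divide_distrib power2_eq_square)
    ultimately show ?thesis by simp
  qed
  have "(\<lambda>n. 1 - (sqrt (2 * real n) + 1) / real n) \<longlonglongrightarrow> 1"
    by real_asymp
  moreover have "\<forall>\<^sub>F n in sequentially. 1 - (sqrt (2 * real n) + 1) / real n \<le> ratio n"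
    using lower by (intro eventually_sequentiallyI[of 1]) simp
  moreover have "\<forall>\<^sub>F n in sequentially. ratio n \<le> 1"
    using upper by (intro eventually_sequentiallyI[of 1]) simp
  ultimately have "ratio \<longlonglongrightarrow> 1"
    by (rule tendsto_sandwich[OF _ _ _ tendsto_const, rotated 2])
  then show ?thesis
    unfolding dense_set_def has_asymptotic_density_def ratio_def .
qed

text \<open>
  Infinity of \<open>A\<close> is used twice: for an element that is large enough to be a candidate, and then
  for a second coordinate beyond the stage at which the first candidate appears.
\<close>
lemma square_meets_late_columns:
  assumes "infinite A" "computably_enumerable A"
  shows "\<not> A \<times> A \<subseteq> - late_columns"
proof -
  from assms(2) obtain r where A: "A = {x. \<exists>y. recf_eval r [x] y}"
    unfolding computably_enumerable_def by blast
  define e where "e = recf_code r"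
  have A_iff: "x \<in> A \<longleftrightarrow> (\<exists>n. halts_within e x n)" for x
    unfolding A e_def by (simp add: halts_within_iff)
  have unbounded: "\<exists>x\<in>A. m \<le> x" for m
    using assms(1) unfolding finite_nat_set_iff_bounded by (meson not_less)
  from unbounded obtain x where "x \<in> A" "triangle e \<le> x"
    by blast
  then obtain n where "is_candidate e \<langle>x, n\<rangle>"
    unfolding A_iff is_candidate_def by auto
  then obtain t where t: "is_first_candidate e t"
    unfolding is_first_candidate_def by (metis (full_types) exists_least_iff)
  then have "left t \<in> A"
    unfolding A_iff is_first_candidate_def is_candidate_def by blast
  moreover have "e < Suc (left t)"
    using t le_triangle[of e] unfolding is_first_candidate_def is_candidate_def by linarith
  moreover from unbounded obtain y where "y \<in> A" "t \<le> y"
    by blast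
  ultimately have "(left t, y) \<in> A \<times> A" "(left t, y) \<in> late_columns"
    using t unfolding late_columns_def by (auto simp: less_Suc_eq_le)
  then show ?thesis by blast
qed

theorem theorem1p4:
  "\<exists>C :: (nat \<times> nat) set. computable_rel C \<and> dense_set C \<and>
     (\<forall>A :: nat set. infinite A \<and> computably_enumerable A \<longrightarrow> \<not> A \<times> A \<subseteq> C)"
  using computable_rel_late_columns dense_set_late_columns square_meets_late_columns
  by blast

end
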